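(* Fix a network architecture $(n_0,\dots,n_m;1)$ with parameter space $\mathbb{R}^D$, and let $\mathcal{F}:\mathbb{R}^{n_0}\times\mathbb{R}^{D}\to\mathbb{R}$ be the parametrized family of ReLU neural networks of this architecture. There exists an algebraic set $Z\subset\mathbb{R}^{n_0}\times\mathbb{R}^{D}$ such that: (i) $\mathcal{F}$ is smooth on the complement of $Z$; (ii) $Z$ is the vanishing set of a polynomial, and is a closed, nowhere dense subset with Lebesgue measure $0$; (iii) the complement of $Z$ consists of finitely many connected components.
   Context: $\mathrm{ReLU}(x)=\max\{0,x\}$, and $\sigma:\mathbb{R}^n\to\mathbb{R}^n$ applies ReLU to each coordinate. A ReLU neural network of architecture $(n_0,\dots,n_m;1)$ (positive integers $n_0,\ldots,n_m$, $n_{m+1}=1$) is a sequence of affine maps $A_i:\mathbb{R}^{n_{i-1}}\to\mathbb{R}^{n_i}$, $A_i(x)=W^{(i)}x+b^{(i)}$, $i=1,\dots,m+1$; its network map is $A_{m+1}\circ(\sigma\circ A_m)\circ\cdots\circ(\sigma\circ A_1):\mathbb{R}^{n_0}\to\mathbb{R}$ (no activation on the last layer). The parameter space is $\mathbb{R}^D$ with $D=\sum_{i=0}^m(n_i+1)n_{i+1}$, a point $s\in\mathbb{R}^D$ listing all entries of all weight matrices $W^{(i)}$ and bias vectors $b^{(i)}$. The parametrized family is the map $\mathcal{F}:\mathbb{R}^{n_0}\times\mathbb{R}^D\to\mathbb{R}$ for which $\mathcal{F}(\cdot,s)$ is the network map with weights and biases given by $s$. *)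

theory Defs
  imports "HOL-Analysis.Analysis"
begin

text \<open>
  An architecture \<open>(n\<^sub>0, \<dots>, n\<^sub>m; 1)\<close> is given by \<open>m\<close> and \<open>n :: nat \<Rightarrow> nat\<close> with
  \<open>n (Suc m) = 1\<close>. As the layer widths vary with the layer, a vector in \<open>\<real>\<^bsup>n i\<^esup>\<close> is represented
  inside the network by a function \<open>nat \<Rightarrow> real\<close> of which only the values at indices below \<open>n i\<close>
  are ever read. The ambient spaces \<open>\<real>\<^bsup>n 0\<^esup>\<close> and \<open>\<real>\<^bsup>D\<^esup>\<close> of the family are Euclidean spaces
  \<open>real^'n\<close> and \<open>real^'d\<close>, with their coordinates labelled by bijections.
\<close>

definition architecture :: "nat \<Rightarrow> (nat \<Rightarrow> nat) \<Rightarrow> bool" where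
  "architecture m n \<longleftrightarrow> (\<forall>i\<le>m. 0 < n i) \<and> n (Suc m) = 1"

text \<open>\<open>Weight i j k\<close> names the entry of the \<open>i\<close>-th weight matrix in row \<open>j\<close> and column \<open>k\<close>
  (rows and columns counted from 0, layers from 1), \<open>Bias i j\<close> the \<open>j\<close>-th entry of the
  \<open>i\<close>-th bias vector.\<close>

datatype param = Weight nat nat nat | Bias nat nat

definition params :: "nat \<Rightarrow> (nat \<Rightarrow> nat) \<Rightarrow> param set" where
  "params m n =
     {Weight i j k | i j k. i \<in> {1..Suc m} \<and> j < n i \<and> k < n (i - 1)} \<union>
     {Bias i j | i j. i \<in> {1..Suc m} \<and> j < n i}"

lemma card_params: "card (params m n) = (\<Sum>i\<le>m. (n i + 1) * n (Suc i))"
  and finite_params: "finite (params m n)"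
proof -
  let ?A = "SIGMA i:{..m}. {..<n (Suc i)} \<times> {..<n i}"
  let ?B = "SIGMA i:{..m}. {..<n (Suc i)}"
  let ?f = "\<lambda>(i, j, k). Weight (Suc i) j k"
  let ?g = "\<lambda>(i, j). Bias (Suc i) j"
  have W: "{Weight i j k | i j k. i \<in> {1..Suc m} \<and> j < n i \<and> k < n (i - 1)} = ?f ` ?A"
  proof (intro set_eqI iffI)
    fix x assume "x \<in> {Weight i j k | i j k. i \<in> {1..Suc m} \<and> j < n i \<and> k < n (i - 1)}"
    then obtain i j k where x: "x = Weight i j k" "i \<in> {1..Suc m}" "j < n i" "k < n (i - 1)"
      by blast
    from x(2) obtain l where "i = Suc l" by (cases i) auto
    with x have "x = ?f (l, j, k)" "(l, j, k) \<in> ?A" by auto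
    then show "x \<in> ?f ` ?A" by blast
  qed auto
  have B: "{Bias i j | i j. i \<in> {1..Suc m} \<and> j < n i} = ?g ` ?B"
  proof (intro set_eqI iffI)
    fix x assume "x \<in> {Bias i j | i j. i \<in> {1..Suc m} \<and> j < n i}"
    then obtain i j where x: "x = Bias i j" "i \<in> {1..Suc m}" "j < n i"
      by blast
    from x(2) obtain l where "i = Suc l" by (cases i) auto
    with x have "x = ?g (l, j)" "(l, j) \<in> ?B" by auto
    then show "x \<in> ?g ` ?B" by blast
  qed auto
  have fin: "finite ?A" "finite ?B" by auto
  show "finite (params m n)"
    unfolding params_def W B using fin by blast
  have "card (params m n) = card (?f ` ?A) + card (?g ` ?B)"
    unfolding params_def W B by (rule card_Un_disjoint) (use fin in auto)
  also have "card (?f ` ?A) = card ?A"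
    by (rule card_image) (auto simp: inj_on_def)
  also have "card (?g ` ?B) = card ?B"
    by (rule card_image) (auto simp: inj_on_def)
  also have "card ?A + card ?B = (\<Sum>i\<le>m. (n i + 1) * n (Suc i))"
    by (simp add: card_SigmaI sum.distrib algebra_simps)
  finally show "card (params m n) = (\<Sum>i\<le>m. (n i + 1) * n (Suc i))" .
qed

definition ReLU :: "real \<Rightarrow> real" where
  "ReLU x = max 0 x"

definition affine_layer ::
    "(nat \<Rightarrow> nat) \<Rightarrow> (param \<Rightarrow> real) \<Rightarrow> nat \<Rightarrow> (nat \<Rightarrow> real) \<Rightarrow> nat \<Rightarrow> real" where
  "affine_layer n \<theta> i x = (\<lambda>j. (\<Sum>k<n (i - 1). \<theta> (Weight i j k) * x k) + \<theta> (Bias i j))"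

primrec hidden_layer ::
    "(nat \<Rightarrow> nat) \<Rightarrow> (param \<Rightarrow> real) \<Rightarrow> nat \<Rightarrow> (nat \<Rightarrow> real) \<Rightarrow> nat \<Rightarrow> real" where
  "hidden_layer n \<theta> 0 x = x"
| "hidden_layer n \<theta> (Suc i) x = ReLU \<circ> affine_layer n \<theta> (Suc i) (hidden_layer n \<theta> i x)"

definition network_map ::
    "nat \<Rightarrow> (nat \<Rightarrow> nat) \<Rightarrow> (param \<Rightarrow> real) \<Rightarrow> (nat \<Rightarrow> real) \<Rightarrow> real" where
  "network_map m n \<theta> x = affine_layer n \<theta> (Suc m) (hidden_layer n \<theta> m x) 0"

definition relu_family ::
    "nat \<Rightarrow> (nat \<Rightarrow> nat) \<Rightarrow> (nat \<Rightarrow> 'n) \<Rightarrow> (param \<Rightarrow> 'd) \<Rightarrow> (real^'n) \<times> (real^'d) \<Rightarrow> real" where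
  "relu_family m n inp par = (\<lambda>(x, s). network_map m n (\<lambda>q. s $ par q) (\<lambda>k. x $ inp k))"

text \<open>\<open>C\<^sup>k\<close> and \<open>C\<^sup>\<infinity>\<close> functions; meaningful for open \<open>S\<close>, since the derivatives are two-sided.\<close>

primrec C_k_on :: "nat \<Rightarrow> ('a::euclidean_space \<Rightarrow> 'b::real_normed_vector) \<Rightarrow> 'a set \<Rightarrow> bool" where
  "C_k_on 0 f S \<longleftrightarrow> continuous_on S f"
| "C_k_on (Suc k) f S \<longleftrightarrow>
     (\<forall>x\<in>S. f differentiable (at x)) \<and>
     (\<forall>v. C_k_on k (\<lambda>x. frechet_derivative f (at x) v) S)"

definition smooth_on :: "('a::euclidean_space \<Rightarrow> 'b::real_normed_vector) \<Rightarrow> 'a set \<Rightarrow> bool" where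
  "smooth_on f S \<longleftrightarrow> (\<forall>k. C_k_on k f S)"

definition algebraic_set :: "'a::euclidean_space set \<Rightarrow> bool" where
  "algebraic_set Z \<longleftrightarrow>
     (\<exists>P. finite P \<and> (\<forall>p\<in>P. real_polynomial_function p) \<and> Z = {z. \<forall>p\<in>P. p z = 0})"

definition nowhere_dense :: "'a::topological_space set \<Rightarrow> bool" where
  "nowhere_dense S \<longleftrightarrow> interior (closure S) = {}"

end

theory Submission
  imports Defs
begin

text \<open>
  Fix which hidden neurons are active. Every pre-activation is then a polynomial in the input and
  the parameters, and it is affine in its own bias with leading coefficient 1. Let \<open>Z\<close> be the union
  of the zero sets of these polynomials over all patterns and neurons. Off \<open>Z\<close> the pattern is locally
  constant, so the family is locally polynomial. Each zero set is a graph over the remaining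
  coordinates, so \<open>Z\<close> is a null set.

  The complement of the zero set of any polynomial \<open>p\<close> has finitely many components. Given components
  \<open>C\<^sub>1, \<dots>, C\<^sub>N\<close>, take a ball of radius \<open>r\<close> that meets all of them, and put
  \<open>q(x) = p(x)\<^sup>2 (r\<^sup>2 - |x|\<^sup>2)\<close>, which is positive inside and zero on the frontier of each
  \<open>C\<^sub>i \<inter> ball 0 r\<close>. For every small vector \<open>c\<close> the function \<open>q(x) - c \<bullet> x\<close> has an interior maximum
  there, so the gradient of \<open>q\<close> takes the value \<open>c\<close> at least \<open>N\<close> times. By a dimension count each
  coordinate function is algebraic over the components of a polynomial map, of a degree that depends
  only on the dimension and the degree of the map. This bounds the generic fibres of the gradient,
  and thereby \<open>N\<close>, independently of \<open>r\<close>.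
\<close>

section \<open>Polynomials of bounded degree\<close>

definition monomial :: "('a::euclidean_space \<Rightarrow> nat) \<Rightarrow> 'a \<Rightarrow> real" where
  "monomial \<alpha> x = (\<Prod>b\<in>Basis. (x \<bullet> b) ^ \<alpha> b)"

text \<open>The degree is bounded in each variable separately, which makes the number of monomials a
  plain power \<open>(d + 1) ^ DIM('a)\<close>.\<close>

definition box_polys :: "nat \<Rightarrow> ('a::euclidean_space \<Rightarrow> real) set" where
  "box_polys d = {f. \<exists>c. f = (\<lambda>x. \<Sum>\<alpha>\<in>Basis \<rightarrow>\<^sub>E {..d}. c \<alpha> * monomial \<alpha> x)}"

lemma box_polysI:
  "(\<And>x. f x = (\<Sum>\<alpha>\<in>Basis \<rightarrow>\<^sub>E {..d}. c \<alpha> * monomial \<alpha> x)) \<Longrightarrow> f \<in> box_polys d"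
  unfolding box_polys_def by blast

lemma box_polys_monomial:
  fixes \<alpha> :: "'a::euclidean_space \<Rightarrow> nat"
  assumes "\<And>b. b \<in> Basis \<Longrightarrow> \<alpha> b \<le> d"
  shows "monomial \<alpha> \<in> box_polys d"
proof -
  \<comment> \<open>The index set holds extensional functions only, so \<alpha> is cut off outside
    \<open>Basis\<close>, where \<open>monomial\<close> does not read it.\<close>
  let ?\<beta> = "restrict \<alpha> Basis" and ?I = "(Basis :: 'a set) \<rightarrow>\<^sub>E {..d}"
  have fin: "finite ?I" by (simp add: finite_PiE)
  have mem: "?\<beta> \<in> ?I" using assms by auto
  show ?thesis
  proof (rule box_polysI)
    fix x :: 'a
    have "(\<Sum>\<gamma>\<in>?I. (if ?\<beta> = \<gamma> then 1 else 0) * monomial \<gamma> x)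
        = (\<Sum>\<gamma>\<in>?I. if ?\<beta> = \<gamma> then monomial \<gamma> x else 0)"
      by (rule sum.cong) auto
    also have "\<dots> = monomial ?\<beta> x"
      using mem fin by (simp add: sum.delta')
    also have "\<dots> = monomial \<alpha> x"
      by (simp add: monomial_def)
    finally show "monomial \<alpha> x = (\<Sum>\<gamma>\<in>?I. (if ?\<beta> = \<gamma> then 1 else 0) * monomial \<gamma> x)"
      by simp
  qed
qed

lemma box_polys_add:
  assumes "f \<in> box_polys d" "g \<in> box_polys d"
  shows "(\<lambda>x. f x + g x) \<in> box_polys d"
proof -
  obtain c c' where f: "f = (\<lambda>x. \<Sum>\<alpha>\<in>Basis \<rightarrow>\<^sub>E {..d}. c \<alpha> * monomial \<alpha> x)"
    and g: "g = (\<lambda>x. \<Sum>\<alpha>\<in>Basis \<rightarrow>\<^sub>E {..d}. c' \<alpha> * monomial \<alpha> x)"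
    using assms by (auto simp: box_polys_def)
  show ?thesis
    by (rule box_polysI[where c = "\<lambda>\<alpha>. c \<alpha> + c' \<alpha>"])
      (simp add: f g sum.distrib algebra_simps)
qed

lemma box_polys_scale:
  assumes "f \<in> box_polys d"
  shows "(\<lambda>x. r * f x) \<in> box_polys d"
proof -
  obtain c where f: "f = (\<lambda>x. \<Sum>\<alpha>\<in>Basis \<rightarrow>\<^sub>E {..d}. c \<alpha> * monomial \<alpha> x)"
    using assms by (auto simp: box_polys_def)
  show ?thesis
    by (rule box_polysI[where c = "\<lambda>\<alpha>. r * c \<alpha>"])
      (simp add: f sum_distrib_left algebra_simps)
qed

lemma box_polys_const: "(\<lambda>x. r) \<in> box_polys d"
  using box_polys_scale[OF box_polys_monomial[of "\<lambda>_. 0" d], of r] by (simp add: monomial_def)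

lemma box_polys_sum:
  assumes "\<And>i. i \<in> I \<Longrightarrow> f i \<in> box_polys d"
  shows "(\<lambda>x. \<Sum>i\<in>I. f i x) \<in> box_polys d"
  using assms
  by (induction I rule: infinite_finite_induct) (auto simp: box_polys_const intro: box_polys_add)

lemma box_polys_mult:
  fixes f g :: "'a::euclidean_space \<Rightarrow> real"
  assumes "f \<in> box_polys d" "g \<in> box_polys e"
  shows "(\<lambda>x. f x * g x) \<in> box_polys (d + e)"
proof -
  let ?I = "\<lambda>d. (Basis :: 'a set) \<rightarrow>\<^sub>E {..d}"
  obtain c c' where f: "f = (\<lambda>x. \<Sum>\<alpha>\<in>?I d. c \<alpha> * monomial \<alpha> x)"
    and g: "g = (\<lambda>x. \<Sum>\<alpha>\<in>?I e. c' \<alpha> * monomial \<alpha> x)"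
    using assms by (auto simp: box_polys_def)
  have "(\<lambda>x. f x * g x)
      = (\<lambda>x. \<Sum>\<alpha>\<in>?I d. \<Sum>\<beta>\<in>?I e. (c \<alpha> * c' \<beta>) * monomial (\<lambda>b. \<alpha> b + \<beta> b) x)"
    unfolding f g sum_product
    by (intro ext sum.cong refl) (simp add: monomial_def power_add prod.distrib)
  moreover have "(\<lambda>x. \<Sum>\<alpha>\<in>?I d. \<Sum>\<beta>\<in>?I e. (c \<alpha> * c' \<beta>) * monomial (\<lambda>b. \<alpha> b + \<beta> b) x)
      \<in> box_polys (d + e)"
  proof (intro box_polys_sum box_polys_scale box_polys_monomial)
    fix \<alpha> \<beta> and b :: 'a
    assume "\<alpha> \<in> ?I d" "\<beta> \<in> ?I e" "b \<in> Basis"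
    then have "\<alpha> b \<in> {..d}" "\<beta> b \<in> {..e}" by blast+
    then show "\<alpha> b + \<beta> b \<le> d + e" by simp
  qed
  ultimately show ?thesis by simp
qed

lemma box_polys_mono:
  assumes "f \<in> box_polys d" "d \<le> e"
  shows "f \<in> box_polys e"
  \<comment> \<open>Multiplication by the constant 1, taken with degree \<open>e - d\<close>, raises
    the bound.\<close>
  using box_polys_mult[OF assms(1) box_polys_const[of 1 "e - d"]] assms(2) by simp

lemma box_polys_inner_Basis:
  assumes "b \<in> Basis"
  shows "(\<lambda>x. x \<bullet> b) \<in> box_polys 1"
proof -
  have "(\<lambda>x. x \<bullet> b) = monomial (\<lambda>b'. if b' = b then 1 else 0)"
  proof
    fix x :: 'a
    have "monomial (\<lambda>b'. if b' = b then 1 else 0) x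
        = (\<Prod>b'\<in>Basis. if b' = b then x \<bullet> b' else 1)"
      unfolding monomial_def by (rule prod.cong) auto
    also have "\<dots> = x \<bullet> b" using assms by (simp add: prod.delta)
    finally show "x \<bullet> b = monomial (\<lambda>b'. if b' = b then 1 else 0) x" by simp
  qed
  then show ?thesis by (simp add: box_polys_monomial)
qed

lemma box_polys_bounded_linear:
  fixes f :: "'a::euclidean_space \<Rightarrow> real"
  assumes "bounded_linear f"
  shows "f \<in> box_polys 1"
proof -
  have "f = (\<lambda>x. \<Sum>b\<in>Basis. f b * (x \<bullet> b))"
  proof
    fix x
    interpret bounded_linear f by fact
    have "f x = f (\<Sum>b\<in>Basis. (x \<bullet> b) *\<^sub>R b)" by (simp add: euclidean_representation)
    also have "\<dots> = (\<Sum>b\<in>Basis. f b * (x \<bullet> b))"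
      by (simp add: sum scaleR mult.commute)
    finally show "f x = (\<Sum>b\<in>Basis. f b * (x \<bullet> b))" .
  qed
  also have "\<dots> \<in> box_polys 1"
    by (intro box_polys_sum box_polys_scale box_polys_inner_Basis)
  finally show ?thesis .
qed

lemma box_polys_power:
  assumes "f \<in> box_polys d"
  shows "(\<lambda>x. f x ^ k) \<in> box_polys (k * d)"
  using assms by (induction k) (auto simp: box_polys_const intro!: box_polys_mult)

lemma box_polys_prod:
  assumes "\<And>i. i \<in> I \<Longrightarrow> f i \<in> box_polys (d i)"
  shows "(\<lambda>x. \<Prod>i\<in>I. f i x) \<in> box_polys (\<Sum>i\<in>I. d i)"
  using assms
  by (induction I rule: infinite_finite_induct) (auto simp: box_polys_const intro!: box_polys_mult)

section \<open>Total degree and differentiation\<close>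

text \<open>Bounds the total degree. The inductive form lets derivatives be treated rule by rule,
  while \<open>box_polys\<close> serves for counting monomials.\<close>

inductive degree_le :: "nat \<Rightarrow> ('a::euclidean_space \<Rightarrow> real) \<Rightarrow> bool" where
  const: "degree_le 0 (\<lambda>x. r)"
| linear: "bounded_linear f \<Longrightarrow> degree_le 1 f"
| add: "degree_le d f \<Longrightarrow> degree_le d g \<Longrightarrow> degree_le d (\<lambda>x. f x + g x)"
| mult: "degree_le d f \<Longrightarrow> degree_le e g \<Longrightarrow> degree_le (d + e) (\<lambda>x. f x * g x)"
| mono: "degree_le d f \<Longrightarrow> d \<le> e \<Longrightarrow> degree_le e f"

lemma degree_le_imp_box_polys: "degree_le d f \<Longrightarrow> f \<in> box_polys d"
  by (induction rule: degree_le.induct)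
    (auto intro: box_polys_const box_polys_bounded_linear box_polys_add box_polys_mult box_polys_mono
      simp del: One_nat_def)

lemma degree_le_imp_real_polynomial_function: "degree_le d f \<Longrightarrow> real_polynomial_function f"
  by (induction rule: degree_le.induct) auto

lemma real_polynomial_function_imp_degree_le:
  fixes p :: "'a::euclidean_space \<Rightarrow> real"
  assumes "real_polynomial_function p"
  shows "\<exists>d. degree_le d p"
  using assms
proof (induction rule: real_polynomial_function.induct)
  case (add f g)
  then obtain d e where "degree_le d f" "degree_le e g" by blast
  then have "degree_le (max d e) f" "degree_le (max d e) g"
    by (auto intro: degree_le.mono)
  then show ?case by (blast intro: degree_le.add)
qed (blast intro: degree_le.intros)+

text \<open>Sum and product rule, by induction. The bound stays \<open>d\<close> instead of dropping
  to \<open>d - 1\<close>: the later count only needs a bound that does not depend on the radius of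
  the ball.\<close>

lemma degree_le_has_derivative:
  assumes "degree_le d f"
  shows "\<exists>f'. (\<forall>x. (f has_derivative f' x) (at x)) \<and> (\<forall>v. degree_le d (\<lambda>x. f' x v))"
  using assms
proof (induction rule: degree_le.induct)
  case (const r)
  show ?case
    by (rule exI[of _ "\<lambda>x v. 0"]) (auto intro: degree_le.const)
next
  case (linear f)
  show ?case
    by (rule exI[of _ "\<lambda>x. f"])
      (auto intro!: bounded_linear_imp_has_derivative linear intro: degree_le.mono[OF degree_le.const])
next
  case (add d f g)
  then obtain f' g' where
    "\<And>x. (f has_derivative f' x) (at x)" "\<And>v. degree_le d (\<lambda>x. f' x v)"
    "\<And>x. (g has_derivative g' x) (at x)" "\<And>v. degree_le d (\<lambda>x. g' x v)"
    by blast
  then show ?case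
    by (intro exI[of _ "\<lambda>x v. f' x v + g' x v"]) (auto intro: has_derivative_add degree_le.add)
next
  case (mult d f e g)
  then obtain f' g' where
    f': "\<And>x. (f has_derivative f' x) (at x)" "\<And>v. degree_le d (\<lambda>x. f' x v)" and
    g': "\<And>x. (g has_derivative g' x) (at x)" "\<And>v. degree_le e (\<lambda>x. g' x v)"
    by blast
  show ?case
  proof (intro exI conjI allI)
    show "((\<lambda>x. f x * g x) has_derivative (\<lambda>v. f x * g' x v + f' x v * g x)) (at x)" for x
      using f'(1) g'(1) by (rule has_derivative_mult)
    show "degree_le (d + e) (\<lambda>x. f x * g' x v + f' x v * g x)" for v
      by (rule degree_le.add; rule degree_le.mult) (rule mult.hyps f' g')+
  qed
next
  case (mono d f e)
  then show ?case by (blast intro: degree_le.mono)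
qed

section \<open>Linear systems and nonvanishing of polynomials\<close>

text \<open>Gaussian elimination with equations \<open>A\<close> and unknowns \<open>J\<close>. An
  equation with zero coefficients is dropped; any other one eliminates an unknown.\<close>

lemma nontrivial_linear_relation:
  fixes c :: "'j \<Rightarrow> 'i \<Rightarrow> real"
  assumes "finite A" "finite J" "card A < card J"
  shows "\<exists>u. (\<exists>j\<in>J. u j \<noteq> 0) \<and> (\<forall>i\<in>A. (\<Sum>j\<in>J. u j * c j i) = 0)"
  using assms
proof (induction A arbitrary: J c rule: finite_induct)
  case empty
  then have "J \<noteq> {}" by auto
  then show ?case by (intro exI[of _ "\<lambda>_. 1"]) auto
next
  case (insert a A)
  show ?case
  proof (cases "\<forall>j\<in>J. c j a = 0")
    case True
    have "card A < card J" using insert by simp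
    from insert.IH[OF insert.prems(1) this, of c] obtain u
      where "\<exists>j\<in>J. u j \<noteq> 0" "\<forall>i\<in>A. (\<Sum>j\<in>J. u j * c j i) = 0" by blast
    with True show ?thesis by (intro exI[of _ u]) auto
  next
    case False
    then obtain k where k: "k \<in> J" "c k a \<noteq> 0" by blast
    let ?J = "J - {k}"
    have J: "finite ?J" "card A < card ?J" using insert k by auto
    \<comment> \<open>These are the coefficients left after unknown \<open>k\<close> has been
      eliminated by means of equation \<open>a\<close>.\<close>
    from insert.IH[OF this, of "\<lambda>j i. c j i - c j a / c k a * c k i"] obtain u
      where u: "\<exists>j\<in>?J. u j \<noteq> 0"
        "\<And>i. i \<in> A \<Longrightarrow> (\<Sum>j\<in>?J. u j * (c j i - c j a / c k a * c k i)) = 0" by blast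
    define s where "s = (\<Sum>j\<in>?J. u j * c j a)"
    \<comment> \<open>Back substitution: the value at \<open>k\<close> is forced by equation
      \<open>a\<close>.\<close>
    define w where "w = u(k := - s / c k a)"
    have split: "(\<Sum>j\<in>J. w j * c j i) = - s / c k a * c k i + (\<Sum>j\<in>?J. u j * c j i)" for i
    proof -
      have "(\<Sum>j\<in>J. w j * c j i) = w k * c k i + (\<Sum>j\<in>?J. w j * c j i)"
        using k insert.prems(1) by (simp add: sum.remove)
      also have "(\<Sum>j\<in>?J. w j * c j i) = (\<Sum>j\<in>?J. u j * c j i)"
        by (rule sum.cong) (auto simp: w_def)
      finally show ?thesis by (simp add: w_def)
    qed
    have "(\<Sum>j\<in>J. w j * c j i) = 0" if i: "i \<in> insert a A" for i
    proof (cases "i = a")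
      case True
      show ?thesis unfolding split True using k(2) by (simp add: s_def)
    next
      case False
      then have "(\<Sum>j\<in>?J. u j * c j i) - (\<Sum>j\<in>?J. u j * (c j a / c k a * c k i)) = 0"
        using u(2)[of i] i by (simp add: algebra_simps sum_subtractf)
      moreover have "(\<Sum>j\<in>?J. u j * (c j a / c k a * c k i)) = s / c k a * c k i"
        by (simp add: s_def sum_distrib_right sum_distrib_left sum_divide_distrib mult_ac)
      ultimately show ?thesis unfolding split by simp
    qed
    moreover have "\<exists>j\<in>J. w j \<noteq> 0" using u(1) by (auto simp: w_def)
    ultimately show ?thesis by blast
  qed
qed

text \<open>One variable at a time: by induction some coefficient of the expansion in powers of
  variable \<open>a\<close> is nonzero at a point of the smaller grid, and the resulting univariate
  polynomial has too few roots to fill \<open>S a\<close>.\<close>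

lemma nonzero_polynomial_on_grid:
  fixes u :: "('b \<Rightarrow> nat) \<Rightarrow> real" and S :: "'b \<Rightarrow> real set"
  assumes "finite B" "\<And>b. b \<in> B \<Longrightarrow> infinite (S b)"
    and "\<beta> \<in> B \<rightarrow>\<^sub>E {..d}" "u \<beta> \<noteq> 0"
  shows "\<exists>c\<in>Pi B S. (\<Sum>\<alpha>\<in>B \<rightarrow>\<^sub>E {..d}. u \<alpha> * (\<Prod>b\<in>B. c b ^ \<alpha> b)) \<noteq> 0"
  using assms
proof (induction B arbitrary: u \<beta> rule: finite_induct)
  case empty
  then show ?case by (auto simp: PiE_empty_domain)
next
  case (insert a B)
  let ?I = "B \<rightarrow>\<^sub>E {..d}"
  have "\<beta> a \<le> d" using insert.prems(2) by auto
  obtain \<gamma> where \<gamma>: "\<gamma> \<in> ?I" "\<beta> = \<gamma>(a := \<beta> a)"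
    using insert.prems(2) insert.hyps(2) by (auto simp: PiE_insert_eq)
  obtain c where c: "c \<in> Pi B S" "(\<Sum>\<alpha>\<in>?I. u (\<alpha>(a := \<beta> a)) * (\<Prod>b\<in>B. c b ^ \<alpha> b)) \<noteq> 0"
    using insert.IH[of \<gamma> "\<lambda>\<alpha>. u (\<alpha>(a := \<beta> a))"] insert.prems \<gamma> by auto
  define C where "C k = (\<Sum>\<alpha>\<in>?I. u (\<alpha>(a := k)) * (\<Prod>b\<in>B. c b ^ \<alpha> b))" for k
  have "finite {t. (\<Sum>k\<le>d. C k * t ^ k) = 0}"
    unfolding Transcendental.polyfun_finite_roots using c(2) \<open>\<beta> a \<le> d\<close> unfolding C_def by blast
  moreover have "infinite (S a)" using insert.prems(1) by simp
  ultimately obtain t where t: "t \<in> S a" "(\<Sum>k\<le>d. C k * t ^ k) \<noteq> 0"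
    by (metis (mono_tags, lifting) finite_subset mem_Collect_eq subsetI)
  let ?c = "c(a := t)"
  have inj: "inj_on (\<lambda>(k, \<alpha>). \<alpha>(a := k)) ({..d} \<times> ?I)"
    using insert.hyps(2) by (rule inj_combinator)
  have "(\<Sum>\<alpha>\<in>insert a B \<rightarrow>\<^sub>E {..d}. u \<alpha> * (\<Prod>b\<in>insert a B. ?c b ^ \<alpha> b))
      = (\<Sum>(k, \<alpha>)\<in>{..d} \<times> ?I. u (\<alpha>(a := k)) * (\<Prod>b\<in>insert a B. ?c b ^ (\<alpha>(a := k)) b))"
    unfolding PiE_insert_eq by (subst sum.reindex[OF inj]) (simp add: case_prod_unfold)
  also have "\<dots> = (\<Sum>(k, \<alpha>)\<in>{..d} \<times> ?I. u (\<alpha>(a := k)) * (\<Prod>b\<in>B. c b ^ \<alpha> b) * t ^ k)"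
  proof (rule sum.cong[OF refl], clarify)
    fix k \<alpha>
    have "(\<Prod>b\<in>B. ?c b ^ (\<alpha>(a := k)) b) = (\<Prod>b\<in>B. c b ^ \<alpha> b)"
      using insert.hyps(2) by (intro prod.cong) auto
    then show "u (\<alpha>(a := k)) * (\<Prod>b\<in>insert a B. ?c b ^ (\<alpha>(a := k)) b)
        = u (\<alpha>(a := k)) * (\<Prod>b\<in>B. c b ^ \<alpha> b) * t ^ k"
      using insert.hyps by simp
  qed
  also have "\<dots> = (\<Sum>k\<le>d. C k * t ^ k)"
    unfolding C_def by (simp add: sum.cartesian_product sum_distrib_right)
  finally have "(\<Sum>\<alpha>\<in>insert a B \<rightarrow>\<^sub>E {..d}. u \<alpha> * (\<Prod>b\<in>insert a B. ?c b ^ \<alpha> b)) \<noteq> 0"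
    using t(2) by simp
  moreover have "?c \<in> Pi (insert a B) S"
    using c(1) t(1) by auto
  ultimately show ?case by blast
qed

text \<open>A box inside \<open>U\<close> is a grid with infinite sides.\<close>

lemma nonzero_polynomial_on_open:
  fixes U :: "'a::euclidean_space set"
  assumes "open U" "U \<noteq> {}" "\<beta> \<in> Basis \<rightarrow>\<^sub>E {..d}" "u \<beta> \<noteq> 0"
  shows "\<exists>c\<in>U. (\<Sum>\<alpha>\<in>Basis \<rightarrow>\<^sub>E {..d}. u \<alpha> * monomial \<alpha> c) \<noteq> 0"
proof -
  obtain z where "z \<in> U" using assms(2) by blast
  then obtain l r where lr: "box l r \<subseteq> U" "\<forall>b\<in>Basis. l \<bullet> b < r \<bullet> b"
    using open_contains_box[OF assms(1)] by metis
  have "infinite {l \<bullet> b<..<r \<bullet> b}" if "b \<in> Basis" for b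
    using lr(2) that by (simp add: infinite_Ioo)
  from nonzero_polynomial_on_grid[where u = u and S = "\<lambda>b. {l \<bullet> b<..<r \<bullet> b}", OF finite_Basis this assms(3,4)]
  obtain c
    where c: "c \<in> (\<Pi> b\<in>Basis. {l \<bullet> b<..<r \<bullet> b})"
      "(\<Sum>\<alpha>\<in>Basis \<rightarrow>\<^sub>E {..d}. u \<alpha> * (\<Prod>b\<in>Basis. c b ^ \<alpha> b)) \<noteq> 0"
    by blast
  let ?c = "\<Sum>b\<in>Basis. c b *\<^sub>R b"
  have inner: "?c \<bullet> b = c b" if "b \<in> Basis" for b
    using that by simp
  have "?c \<in> U"
    using c(1) inner by (intro subsetD[OF lr(1)]) (auto simp: mem_box)
  moreover have "monomial \<alpha> ?c = (\<Prod>b\<in>Basis. c b ^ \<alpha> b)" for \<alpha>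
    unfolding monomial_def by (rule prod.cong) (simp_all only: inner)
  ultimately show ?thesis using c(2) by (intro bexI[of _ ?c]) simp_all
qed

section \<open>Components of the complement of a zero set\<close>

text \<open>The \<open>(a + 1) ^ (DIM('a) + 1)\<close> products \<open>l ^ i * monomial \<beta> \<circ> F\<close> have degree at most
  \<open>e = a + DIM('a) * (a * d)\<close> in each variable. The value of \<open>a\<close> is chosen such that they outnumber the
  \<open>(e + 1) ^ DIM('a)\<close> monomials of that degree.\<close>

lemma algebraic_relation:
  fixes F :: "'a::euclidean_space \<Rightarrow> 'a" and l :: "'a \<Rightarrow> real"
  assumes F: "\<And>b. b \<in> Basis \<Longrightarrow> (\<lambda>x. F x \<bullet> b) \<in> box_polys d"
    and l: "l \<in> box_polys 1"
    and a: "a = (DIM('a) * d + 1) ^ DIM('a)"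
  shows "\<exists>u. (\<exists>i\<le>a. \<exists>\<beta>\<in>Basis \<rightarrow>\<^sub>E {..a}. u i \<beta> \<noteq> 0) \<and>
    (\<forall>x. (\<Sum>i\<le>a. (\<Sum>\<beta>\<in>Basis \<rightarrow>\<^sub>E {..a}. u i \<beta> * monomial \<beta> (F x)) * l x ^ i) = 0)"
proof -
  let ?I = "\<lambda>k. (Basis :: 'a set) \<rightarrow>\<^sub>E {..k::nat}"
  define e where "e = a + DIM('a) * (a * d)"
  define g where "g j x = l x ^ fst j * monomial (snd j) (F x)" for j x
  let ?J = "{..a} \<times> ?I a"
  have g: "g j \<in> box_polys e" if J: "j \<in> ?J" for j
  proof -
    obtain i \<beta> where ij: "i \<in> {..a}" "\<beta> \<in> ?I a" "j = (i, \<beta>)"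
      using J by (rule SigmaE)
    then have j: "j = (i, \<beta>)" "i \<le> a" "\<beta> \<in> ?I a"
      by simp_all
    have "(\<lambda>x. l x ^ i) \<in> box_polys (i * 1)"
      using l by (rule box_polys_power)
    moreover have "(\<lambda>x. \<Prod>b\<in>Basis. (F x \<bullet> b) ^ \<beta> b) \<in> box_polys (\<Sum>b\<in>Basis. \<beta> b * d)"
      using F by (intro box_polys_prod box_polys_power) auto
    ultimately have "g j \<in> box_polys (i * 1 + (\<Sum>b\<in>Basis. \<beta> b * d))"
      unfolding g_def[abs_def] j fst_conv snd_conv monomial_def by (rule box_polys_mult)
    moreover have "(\<Sum>b\<in>Basis. \<beta> b * d) \<le> (\<Sum>b\<in>(Basis :: 'a set). a * d)"
      using j(3) by (intro sum_mono mult_right_mono) auto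
    then have "i * 1 + (\<Sum>b\<in>Basis. \<beta> b * d) \<le> e"
      using j(2) by (simp add: e_def)
    ultimately show ?thesis
      by (rule box_polys_mono)
  qed
  then have "\<forall>j\<in>?J. \<exists>c. g j = (\<lambda>x. \<Sum>\<alpha>\<in>?I e. c \<alpha> * monomial \<alpha> x)"
    unfolding box_polys_def by blast
  from bchoice[OF this] obtain C
    where C': "\<forall>j\<in>?J. g j = (\<lambda>x. \<Sum>\<alpha>\<in>?I e. C j \<alpha> * monomial \<alpha> x)" ..
  have C: "g j x = (\<Sum>\<alpha>\<in>?I e. C j \<alpha> * monomial \<alpha> x)" if "j \<in> ?J" for j x
    using fun_cong[OF bspec[OF C' that]] .
  \<comment> \<open>Raised to the power \<open>DIM('a)\<close>, the second factor becomes exactly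
    \<open>a\<close>, and \<open>a < a + 1\<close> gives the strict inequality.\<close>
  have "e + 1 \<le> (a + 1) * (DIM('a) * d + 1)"
    by (simp add: e_def algebra_simps)
  then have "(e + 1) ^ DIM('a) \<le> ((a + 1) * (DIM('a) * d + 1)) ^ DIM('a)"
    by (rule power_mono) simp
  also have "\<dots> = (a + 1) ^ DIM('a) * a"
    by (simp only: power_mult_distrib a)
  also have "\<dots> < (a + 1) ^ DIM('a) * (a + 1)"
    by simp
  finally have "(e + 1) ^ DIM('a) < (a + 1) ^ DIM('a) * (a + 1)" .
  then have "card (?I e) < card ?J"
    by (simp add: card_cartesian_product card_funcsetE mult.commute)
  moreover have "finite (?I e)" "finite ?J"
    by (simp_all add: finite_PiE)
  ultimately obtain u where u: "\<exists>j\<in>?J. u j \<noteq> 0"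
    "\<And>\<alpha>. \<alpha> \<in> ?I e \<Longrightarrow> (\<Sum>j\<in>?J. u j * C j \<alpha>) = 0"
    using nontrivial_linear_relation[of "?I e" ?J C] by blast
  have rel: "(\<Sum>i\<le>a. (\<Sum>\<beta>\<in>?I a. u (i, \<beta>) * monomial \<beta> (F x)) * l x ^ i) = 0" for x
  proof -
    have "(\<Sum>i\<le>a. (\<Sum>\<beta>\<in>?I a. u (i, \<beta>) * monomial \<beta> (F x)) * l x ^ i) = (\<Sum>j\<in>?J. u j * g j x)"
      unfolding sum_distrib_right sum.cartesian_product
      by (rule sum.cong) (auto simp: g_def)
    also have "\<dots> = (\<Sum>j\<in>?J. \<Sum>\<alpha>\<in>?I e. u j * C j \<alpha> * monomial \<alpha> x)"
      by (rule sum.cong[OF refl]) (simp only: C sum_distrib_left mult.assoc)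
    also have "\<dots> = (\<Sum>\<alpha>\<in>?I e. (\<Sum>j\<in>?J. u j * C j \<alpha>) * monomial \<alpha> x)"
      by (subst sum.swap) (simp only: sum_distrib_right)
    also have "\<dots> = 0"
      using u(2) by simp
    finally show ?thesis .
  qed
  show ?thesis
    using u(1) rel by (intro exI[of _ "\<lambda>i \<beta>. u (i, \<beta>)"]) auto
qed

section \<open>Generic fibres of polynomial maps\<close>

lemma finite_Int_open_dense:
  assumes "finite B" "\<And>b. b \<in> B \<Longrightarrow> open (W b)"
    and "\<And>b V. b \<in> B \<Longrightarrow> open V \<Longrightarrow> V \<noteq> {} \<Longrightarrow> V \<inter> W b \<noteq> {}"
    and "open U" "U \<noteq> {}"
  shows "\<exists>c\<in>U. \<forall>b\<in>B. c \<in> W b"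
  using assms
proof (induction B arbitrary: U rule: finite_induct)
  case empty
  then show ?case by auto
next
  case (insert a B)
  have "open (U \<inter> W a)" "U \<inter> W a \<noteq> {}"
    using insert.prems by (auto simp: open_Int)
  from insert.IH[OF insert.prems(1,2) this] show ?case
    by auto
qed

text \<open>Each coordinate of a point in the fibre over \<open>c\<close> is a root of a univariate
  polynomial of degree at most \<open>a\<close> whose coefficients depend on \<open>c\<close> alone.
  Where a fixed one of these coefficients is nonzero there are at most \<open>a\<close> roots. This
  happens on an open dense set for each coordinate, and finitely many such sets have a common point
  in \<open>U\<close>.\<close>

lemma generic_finite_fibre:
  fixes F :: "'a::euclidean_space \<Rightarrow> 'a"
  assumes F: "\<And>b. b \<in> Basis \<Longrightarrow> (\<lambda>x. F x \<bullet> b) \<in> box_polys d"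
    and "open U" "U \<noteq> {}"
    and a: "a = (DIM('a) * d + 1) ^ DIM('a)"
  shows "\<exists>c\<in>U. finite {x. F x = c} \<and> card {x. F x = c} \<le> a ^ DIM('a)"
proof -
  let ?I = "(Basis :: 'a set) \<rightarrow>\<^sub>E {..a}"
  have "\<exists>W. open W \<and> (\<forall>V. open V \<longrightarrow> V \<noteq> {} \<longrightarrow> V \<inter> W \<noteq> {}) \<and>
      (\<forall>c\<in>W. \<exists>R. finite R \<and> card R \<le> a \<and> (\<forall>x. F x = c \<longrightarrow> x \<bullet> e \<in> R))"
    if e: "e \<in> Basis" for e
  proof -
    obtain u k \<beta> where k: "k \<le> a" and \<beta>: "\<beta> \<in> ?I" "u k \<beta> \<noteq> 0"
      and rel: "\<And>x. (\<Sum>i\<le>a. (\<Sum>\<beta>\<in>?I. u i \<beta> * monomial \<beta> (F x)) * (x \<bullet> e) ^ i) = 0"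
      using algebraic_relation[OF F box_polys_inner_Basis[OF e] a] by blast
    define G where "G i c = (\<Sum>\<beta>\<in>?I. u i \<beta> * monomial \<beta> c)" for i c
    show ?thesis
    proof (rule exI[of _ "{c. G k c \<noteq> 0}"], intro conjI allI impI ballI)
      show "open {c. G k c \<noteq> 0}"
        unfolding G_def monomial_def by (intro open_Collect_neq continuous_intros)
      show "V \<inter> {c. G k c \<noteq> 0} \<noteq> {}" if "open V" "V \<noteq> {}" for V
        using nonzero_polynomial_on_open[OF that \<beta>(1), of "u k"] \<beta>(2) unfolding G_def by blast
      fix c assume c: "c \<in> {c. G k c \<noteq> 0}"
      let ?R = "{t. (\<Sum>i\<le>a. G i c * t ^ i) = 0}"
      have "finite ?R \<and> card ?R \<le> a"
        using Transcendental.polyfun_rootbound[of "\<lambda>i. G i c" k a] c k by simp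
      moreover have "x \<bullet> e \<in> ?R" if "F x = c" for x
        using rel[of x] unfolding that G_def by simp
      ultimately show "\<exists>R. finite R \<and> card R \<le> a \<and> (\<forall>x. F x = c \<longrightarrow> x \<bullet> e \<in> R)"
        by blast
    qed
  qed
  then have "\<forall>e\<in>Basis. \<exists>W. open W \<and> (\<forall>V. open V \<longrightarrow> V \<noteq> {} \<longrightarrow> V \<inter> W \<noteq> {}) \<and>
      (\<forall>c\<in>W. \<exists>R. finite R \<and> card R \<le> a \<and> (\<forall>x. F x = c \<longrightarrow> x \<bullet> e \<in> R))"
    by blast
  from bchoice[OF this] obtain W where W': "\<forall>e\<in>Basis. open (W e) \<and>
      (\<forall>V. open V \<longrightarrow> V \<noteq> {} \<longrightarrow> V \<inter> W e \<noteq> {}) \<and>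
      (\<forall>c\<in>W e. \<exists>R. finite R \<and> card R \<le> a \<and> (\<forall>x. F x = c \<longrightarrow> x \<bullet> e \<in> R))" ..
  have W: "open (W e)" "\<And>V. open V \<Longrightarrow> V \<noteq> {} \<Longrightarrow> V \<inter> W e \<noteq> {}"
    "\<And>c. c \<in> W e \<Longrightarrow> \<exists>R. finite R \<and> card R \<le> a \<and> (\<forall>x. F x = c \<longrightarrow> x \<bullet> e \<in> R)"
    if "e \<in> Basis" for e
    using bspec[OF W' that] by simp_all
  from finite_Int_open_dense[where W = W, OF finite_Basis W(1,2) assms(2,3)]
  obtain c where c: "c \<in> U" "\<And>e. e \<in> Basis \<Longrightarrow> c \<in> W e"
    by blast
  have "\<forall>e\<in>Basis. \<exists>R. finite R \<and> card R \<le> a \<and> (\<forall>x. F x = c \<longrightarrow> x \<bullet> e \<in> R)"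
    using W(3) c(2) by blast
  from bchoice[OF this] obtain R
    where R': "\<forall>e\<in>Basis. finite (R e) \<and> card (R e) \<le> a \<and> (\<forall>x. F x = c \<longrightarrow> x \<bullet> e \<in> R e)" ..
  have R: "finite (R e)" "card (R e) \<le> a" "\<And>x. F x = c \<Longrightarrow> x \<bullet> e \<in> R e"
    if "e \<in> Basis" for e
    using bspec[OF R' that] by simp_all
  \<comment> \<open>The coordinate tuple determines the point and lies in the product of the root
    sets.\<close>
  define h where "h x = restrict (\<lambda>e. x \<bullet> e) Basis" for x :: 'a
  have inj: "inj_on h {x. F x = c}"
    by (rule inj_onI, rule euclidean_eqI) (metis h_def restrict_apply')
  have sub: "h ` {x. F x = c} \<subseteq> Pi\<^sub>E Basis R"
    using R(3) by (auto simp: h_def)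
  have fin: "finite (Pi\<^sub>E Basis R)"
    using R by (intro finite_PiE) auto
  have "card {x. F x = c} \<le> card (Pi\<^sub>E Basis R)"
    using card_inj_on_le[OF inj sub fin] .
  also have "\<dots> = (\<Prod>e\<in>Basis. card (R e))"
    by (simp add: card_PiE)
  also have "\<dots> \<le> (\<Prod>e\<in>(Basis :: 'a set). a)"
    using R by (intro prod_mono) auto
  finally have "card {x. F x = c} \<le> a ^ DIM('a)"
    by simp
  moreover have "finite {x. F x = c}"
    using inj_on_finite[OF inj sub fin] .
  ultimately show ?thesis
    using c(1) by blast
qed

section \<open>Critical points and the number of components\<close>

text \<open>Maximise \<open>q x - c \<bullet> x\<close> over \<open>closure U\<close>. The linear
  term varies by at most \<open>2 * r * norm c\<close>, which is less than \<open>q y\<close>, so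
  \<open>q\<close> is positive at a maximiser. This keeps it off the frontier, and the derivative
  vanishes there.\<close>

lemma interior_maximum_gives_gradient:
  fixes q :: "'a::euclidean_space \<Rightarrow> real" and U :: "'a set"
  assumes "open U" "bounded U" and r: "\<And>x. x \<in> closure U \<Longrightarrow> norm x \<le> r"
    and q: "\<And>x. (q has_derivative (\<lambda>v. F x \<bullet> v)) (at x)"
    and frontier: "\<And>x. x \<in> frontier U \<Longrightarrow> q x \<le> 0"
    and y: "y \<in> U" and c: "2 * r * norm c < q y"
  shows "\<exists>x\<in>U. F x = c"
proof -
  let ?h = "\<lambda>x. q x - c \<bullet> x"
  have der: "(?h has_derivative (\<lambda>v. F x \<bullet> v - c \<bullet> v)) (at x)" for x
    by (intro derivative_intros q)
  have cont: "continuous_on (closure U) ?h"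
    by (intro continuous_at_imp_continuous_on ballI has_derivative_continuous[OF der])
  have "compact (closure U)" "closure U \<noteq> {}"
    using assms(2) y by auto
  from continuous_attains_sup[OF this cont]
  obtain z where z: "z \<in> closure U" "\<And>x. x \<in> closure U \<Longrightarrow> ?h x \<le> ?h z"
    by blast
  have bound: "\<bar>c \<bullet> x\<bar> \<le> r * norm c" if "x \<in> closure U" for x
    using Cauchy_Schwarz_ineq2[of c x] mult_right_mono[OF r[OF that], of "norm c"]
    by (simp add: mult.commute)
  have "y \<in> closure U"
    using y closure_subset by blast
  then have "q z > 0"
    using z(2)[of y] bound[of y] bound[OF z(1)] c by linarith
  then have "z \<notin> frontier U"
    using frontier[of z] by linarith
  then have zU: "z \<in> U"
    using z(1) \<open>open U\<close> by (simp add: frontier_def interior_open)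
  have "(\<lambda>v. F z \<bullet> v - c \<bullet> v) = (\<lambda>v. 0)"
    by (rule differential_zero_maxmin[OF zU \<open>open U\<close> der])
      (use z(2) closure_subset in blast)
  then have "(F z - c) \<bullet> v = 0" for v
    by (metis inner_diff_left)
  then have "F z = c"
    using inner_eq_zero_iff[of "F z - c"] by simp
  with zU show ?thesis by blast
qed

theorem finite_components_polynomial_complement:
  fixes p :: "'a::euclidean_space \<Rightarrow> real"
  assumes "real_polynomial_function p"
  shows "finite (components (- {x. p x = 0}))"
proof (rule ccontr)
  assume inf: "infinite (components (- {x. p x = 0}))"
  obtain d where d: "degree_le d p"
    using real_polynomial_function_imp_degree_le[OF assms] by blast
  \<comment> \<open>Two factors \<open>p\<close> and one quadratic factor. \<open>D\<close> and
    \<open>a\<close> are fixed before the radius \<open>r\<close>, which depends on the components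
    chosen; otherwise the count would be circular.\<close>
  define D where "D = d + d + 2"
  define a where "a = (DIM('a) * D + 1) ^ DIM('a)"
  obtain K where K: "K \<subseteq> components (- {x. p x = 0})" "finite K" "card K = Suc (a ^ DIM('a))"
    using infinite_arbitrarily_large[OF inf] by blast
  have "\<exists>y. y \<in> C" if "C \<in> K" for C
    using K(1) that in_components_nonempty by blast
  then obtain y where y: "\<And>C. C \<in> K \<Longrightarrow> y C \<in> C"
    by metis
  \<comment> \<open>Adding 1 puts every \<open>y C\<close> strictly inside the ball; inserting 0
    makes \<open>r\<close> positive.\<close>
  define r where "r = Max (insert 0 ((\<lambda>C. norm (y C)) ` K)) + 1"
  have "0 \<le> Max (insert 0 ((\<lambda>C. norm (y C)) ` K))"
    using K(2) by (intro Max_ge) auto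
  then have "r > 0"
    by (simp add: r_def)
  have yr: "norm (y C) < r" if "C \<in> K" for C
  proof -
    have "norm (y C) \<le> Max (insert 0 ((\<lambda>C. norm (y C)) ` K))"
      using K(2) that by (intro Max_ge) auto
    then show ?thesis by (simp add: r_def)
  qed
  define q where "q x = p x * p x * (r\<^sup>2 - x \<bullet> x)" for x
  have "degree_le D q"
  proof -
    have *: "degree_le 2 (\<lambda>x::'a. x \<bullet> x)"
    proof -
      have "degree_le (1 + 1) (\<lambda>x::'a. (x \<bullet> b) * (x \<bullet> b))" for b
        by (intro degree_le.mult degree_le.linear bounded_linear_inner_left)
      then have "degree_le 2 (\<lambda>x::'a. \<Sum>b\<in>B. (x \<bullet> b) * (x \<bullet> b))" for B
      proof (induction B rule: infinite_finite_induct)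
        case (insert b B)
        then show ?case
          using degree_le.add[of 2 "\<lambda>x. (x \<bullet> b) * (x \<bullet> b)"] by (simp add: numeral_2_eq_2)
      qed (auto intro: degree_le.mono[OF degree_le.const])
      from this[of Basis] show ?thesis
        by (subst euclidean_inner)
    qed
    have "degree_le 2 (\<lambda>x::'a. r\<^sup>2 + (- 1) * (x \<bullet> x))"
      using degree_le.mult[OF degree_le.const[of "- 1"] *]
      by (intro degree_le.add degree_le.mono[OF degree_le.const]) (simp_all only: add_0 zero_le_numeral)
    from degree_le.mult[OF degree_le.mult[OF d d] this] show ?thesis
      by (simp add: q_def[abs_def] D_def)
  qed
  then obtain q' where q': "\<And>x. (q has_derivative q' x) (at x)" "\<And>v. degree_le D (\<lambda>x. q' x v)"
    using degree_le_has_derivative by blast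
  \<comment> \<open>\<open>F\<close> is the gradient of \<open>q\<close>.\<close>
  define F where "F x = (\<Sum>b\<in>Basis. q' x b *\<^sub>R b)" for x
  have q'F: "q' x v = F x \<bullet> v" for x v
  proof -
    interpret bounded_linear "q' x"
      using q'(1) by (rule has_derivative_bounded_linear)
    have "q' x v = q' x (\<Sum>b\<in>Basis. (v \<bullet> b) *\<^sub>R b)"
      by (simp add: euclidean_representation)
    also have "\<dots> = (\<Sum>b\<in>Basis. (v \<bullet> b) * q' x b)"
      by (simp add: sum scaleR)
    also have "\<dots> = F x \<bullet> v"
      unfolding F_def inner_sum_left
      by (rule sum.cong) (simp_all add: inner_commute[of v])
    finally show ?thesis .
  qed
  have F: "(\<lambda>x. F x \<bullet> b) \<in> box_polys D" for b
    using degree_le_imp_box_polys[OF q'(2)[of b]] by (simp add: q'F)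
  have "q (y C) > 0" if "C \<in> K" for C
  proof -
    have "p (y C) \<noteq> 0"
      using y[OF that] K(1) that in_components_subset by blast
    moreover have "y C \<bullet> y C < r\<^sup>2"
      using power_strict_mono[OF yr[OF that], of 2] by (simp add: power2_norm_eq_inner)
    ultimately show ?thesis
      by (simp add: q_def zero_less_mult_iff) (metis linorder_neqE_linordered_idom)
  qed
  moreover have "K \<noteq> {}"
    using K(3) by auto
  ultimately obtain \<epsilon> where \<epsilon>: "\<epsilon> > 0" "\<And>C. C \<in> K \<Longrightarrow> \<epsilon> \<le> q (y C)"
    using K(2) by (intro that[of "Min ((\<lambda>C. q (y C)) ` K)"]) auto
  \<comment> \<open>Below this radius \<open>2 * r * norm c < \<epsilon>\<close> holds, so one
    \<open>c\<close> serves all components in \<open>K\<close>.\<close>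
  have "\<epsilon> / (2 * r) > 0"
    using \<epsilon>(1) \<open>r > 0\<close> by simp
  then have "ball 0 (\<epsilon> / (2 * r)) \<noteq> ({} :: 'a set)"
    by simp
  from generic_finite_fibre[OF F open_ball this a_def] obtain c
    where c: "norm c < \<epsilon> / (2 * r)" "finite {x. F x = c}" "card {x. F x = c} \<le> a ^ DIM('a)"
    by (auto simp: dist_norm)
  have "continuous_on UNIV p"
    using assms continuous_real_polymonial_function continuous_at_imp_continuous_on by blast
  then have closed: "closed {x. p x = 0}"
    by (intro closed_Collect_eq continuous_on_const)
  have "\<exists>x\<in>C \<inter> ball 0 r. F x = c" if "C \<in> K" for C
  proof (rule interior_maximum_gives_gradient[where q = q and r = r and y = "y C"])
    have C: "C \<in> components (- {x. p x = 0})"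
      using K(1) that by blast
    then have "open C"
      using closed open_components by blast
    then show "open (C \<inter> ball 0 r)"
      by (intro open_Int open_ball)
    show "bounded (C \<inter> ball 0 r)"
      by (simp add: bounded_Int)
    have cl: "closure (C \<inter> ball 0 r) \<subseteq> cball 0 r"
      by (meson ball_subset_cball closed_cball closure_minimal dual_order.trans inf_le2)
    then show "norm x \<le> r" if "x \<in> closure (C \<inter> ball 0 r)" for x
      using that by auto
    show "(q has_derivative (\<lambda>v. F x \<bullet> v)) (at x)" for x
      using q'(1) by (simp add: q'F[symmetric])
    show "q x \<le> 0" if x: "x \<in> frontier (C \<inter> ball 0 r)" for x
    proof -
      have "x \<in> frontier C \<union> frontier (ball 0 r)"
        using frontier_Int_subset x by blast
      \<comment> \<open>A frontier point of a component is a zero of \<open>p\<close>, one of the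
        ball lies on the sphere; either way a factor of \<open>q\<close> vanishes.\<close>
      then have "p x = 0 \<or> norm x = r"
        using frontier_of_components_closed_complement[OF closed C] \<open>r > 0\<close> by auto
      then show ?thesis
        by (auto simp: q_def power2_norm_eq_inner[symmetric])
    qed
    show "y C \<in> C \<inter> ball 0 r"
      using y yr that by simp
    have "2 * r * norm c < \<epsilon>"
      using c(1) \<open>r > 0\<close> by (simp add: field_simps)
    then show "2 * r * norm c < q (y C)"
      using \<epsilon>(2)[OF that] by simp
  qed
  then have "\<forall>C\<in>K. \<exists>x. x \<in> C \<and> F x = c"
    by blast
  from bchoice[OF this] obtain x where x': "\<forall>C\<in>K. x C \<in> C \<and> F (x C) = c" ..
  have x: "x C \<in> C" "F (x C) = c" if "C \<in> K" for C
    using bspec[OF x' that] by simp_all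
  \<comment> \<open>Distinct components are disjoint, so the fibre over \<open>c\<close> has at
    least \<open>card K\<close> points, more than the bound allows.\<close>
  have "inj_on x K"
  proof (rule inj_onI)
    fix C C' assume C: "C \<in> K" "C' \<in> K" "x C = x C'"
    then have "C \<inter> C' \<noteq> {}"
      using x(1)[of C] x(1)[of C'] by auto
    then show "C = C'"
      using components_nonoverlap[OF subsetD[OF K(1) C(1)] subsetD[OF K(1) C(2)]] by simp
  qed
  moreover have "x ` K \<subseteq> {x. F x = c}"
    using x(2) by blast
  ultimately have "card K \<le> card {x. F x = c}"
    using c(2) by (rule card_inj_on_le)
  then show False
    using c(3) K(3) by simp
qed

section \<open>Locally polynomial functions and null sets\<close>

lemma real_polynomial_function_has_derivative:
  fixes g :: "'a::euclidean_space \<Rightarrow> real"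
  assumes "real_polynomial_function g"
  shows "\<exists>g'. (\<forall>x. (g has_derivative g' x) (at x)) \<and> (\<forall>v. real_polynomial_function (\<lambda>x. g' x v))"
proof -
  obtain d where "degree_le d g"
    using real_polynomial_function_imp_degree_le[OF assms] by blast
  from degree_le_has_derivative[OF this] show ?thesis
    using degree_le_imp_real_polynomial_function by blast
qed

text \<open>The hypothesis passes on to every directional derivative of \<open>f\<close>, so the
  induction on \<open>k\<close> runs with \<open>f\<close> arbitrary.\<close>

lemma C_k_on_if_locally_polynomial:
  fixes f :: "'a::euclidean_space \<Rightarrow> real"
  assumes "\<And>x. x \<in> S \<Longrightarrow> \<exists>U g. open U \<and> x \<in> U \<and> real_polynomial_function g \<and> (\<forall>y\<in>U. f y = g y)"
  shows "C_k_on k f S"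
  using assms
proof (induction k arbitrary: f)
  case 0
  have "isCont f x" if x: "x \<in> S" for x
  proof -
    obtain U g where U: "open U" "x \<in> U" "real_polynomial_function g" "\<forall>y\<in>U. f y = g y"
      using 0[OF x] by blast
    have "isCont g x"
      using U(3) by (rule continuous_real_polymonial_function)
    then show ?thesis
      using U by (subst isCont_cong[where g = g]) (auto simp: eventually_nhds)
  qed
  then show ?case
    by (simp add: continuous_at_imp_continuous_on)
next
  case (Suc k)
  have local_der: "\<exists>U g'. open U \<and> x \<in> U \<and> (\<forall>v. real_polynomial_function (\<lambda>y. g' y v)) \<and>
      (\<forall>y\<in>U. (f has_derivative g' y) (at y))" if x: "x \<in> S" for x
  proof -
    obtain U g where U: "open U" "x \<in> U" "real_polynomial_function g" "\<forall>y\<in>U. f y = g y"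
      using Suc.prems[OF x] by blast
    obtain g' where g': "\<And>y. (g has_derivative g' y) (at y)"
      "\<And>v. real_polynomial_function (\<lambda>y. g' y v)"
      using real_polynomial_function_has_derivative[OF U(3)] by blast
    have "(f has_derivative g' y) (at y)" if "y \<in> U" for y
      by (rule has_derivative_transform_within_open[OF g'(1) U(1) that]) (use U(4) in simp)
    then show ?thesis
      using U(1,2) g'(2) by (intro exI[of _ U] exI[of _ g']) simp
  qed
  have "f differentiable (at x)" if x: "x \<in> S" for x
  proof -
    obtain U g' where "x \<in> U" "\<forall>y\<in>U. (f has_derivative g' y) (at y)"
      using local_der[OF x] by blast
    then have "(f has_derivative g' x) (at x)"
      by blast
    then show ?thesis
      by (rule differentiableI)
  qed
  moreover have "C_k_on k (\<lambda>x. frechet_derivative f (at x) v) S" for v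
  proof (rule Suc.IH)
    fix x assume "x \<in> S"
    from local_der[OF this] obtain U g' where U: "open U" "x \<in> U"
      "\<And>v. real_polynomial_function (\<lambda>y. g' y v)" "\<And>y. y \<in> U \<Longrightarrow> (f has_derivative g' y) (at y)"
      by blast
    have "frechet_derivative f (at y) v = g' y v" if "y \<in> U" for y
      using frechet_derivative_at[OF U(4)[OF that]] by simp
    then show "\<exists>U g. open U \<and> x \<in> U \<and> real_polynomial_function g \<and>
        (\<forall>y\<in>U. frechet_derivative f (at y) v = g y)"
      using U by blast
  qed
  ultimately show ?case by simp
qed

lemma negligible_zeros_of_translation:
  fixes p :: "'a::euclidean_space \<Rightarrow> real"
  assumes "b \<in> Basis" "\<And>x. p differentiable (at x)"
    and shift: "\<And>x t. p (x + t *\<^sub>R b) = p x + t"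
  shows "negligible {x. p x = 0}"
proof -
  txt \<open>The zero set is the image of the hyperplane \<open>?H\<close> under a shear.\<close>
  let ?H = "{x. x \<bullet> b = 0}" and ?\<psi> = "\<lambda>x. x - p x *\<^sub>R b"
  have "?\<psi> differentiable_on ?H"
    by (intro differentiable_at_imp_differentiable_on ballI derivative_intros assms(2))
  moreover have "negligible ?H"
    using assms(1) by (rule negligible_standard_hyperplane)
  ultimately have "negligible (?\<psi> ` ?H)"
    by (intro negligible_differentiable_image_negligible) auto
  moreover have "{x. p x = 0} \<subseteq> ?\<psi> ` ?H"
  proof
    fix x assume "x \<in> {x. p x = 0}"
    \<comment> \<open>Sliding \<open>x\<close> along \<open>b\<close> into the hyperplane changes
      the value of \<open>p\<close> from 0 to \<open>- (x \<bullet> b)\<close>, so the shear carries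
      the point back to \<open>x\<close>.\<close>
    then have "p (x - (x \<bullet> b) *\<^sub>R b) = - (x \<bullet> b)"
      using shift[of x "- (x \<bullet> b)"] by simp
    then have "x = ?\<psi> (x - (x \<bullet> b) *\<^sub>R b)"
      by simp
    moreover have "x - (x \<bullet> b) *\<^sub>R b \<in> ?H"
      using assms(1) by (simp add: inner_diff_left)
    ultimately show "x \<in> ?\<psi> ` ?H"
      by blast
  qed
  ultimately show ?thesis
    by (rule negligible_subset)
qed

section \<open>Networks with a prescribed activation pattern\<close>

text \<open>Hidden layers only: the output layer carries no activation.\<close>

definition neurons :: "nat \<Rightarrow> (nat \<Rightarrow> nat) \<Rightarrow> (nat \<times> nat) set" where
  "neurons m n = (SIGMA i:{1..m}. {..<n i})"

text \<open>Each ReLU is replaced by a fixed gate, open exactly on \<open>A\<close>, which makes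
  every layer polynomial in input and parameters.\<close>

primrec pattern_layer ::
    "(nat \<Rightarrow> nat) \<Rightarrow> (param \<Rightarrow> real) \<Rightarrow> (nat \<times> nat) set \<Rightarrow> nat \<Rightarrow> (nat \<Rightarrow> real) \<Rightarrow> nat \<Rightarrow> real" where
  "pattern_layer n \<theta> A 0 x = x"
| "pattern_layer n \<theta> A (Suc i) x =
     (\<lambda>j. if (Suc i, j) \<in> A then affine_layer n \<theta> (Suc i) (pattern_layer n \<theta> A i x) j else 0)"

lemma finite_neurons: "finite (neurons m n)"
  by (simp add: neurons_def)

lemma affine_layer_cong:
  assumes "\<And>k. k < n (i - 1) \<Longrightarrow> \<theta> (Weight i j k) = \<theta>' (Weight i j k)"
    and "\<theta> (Bias i j) = \<theta>' (Bias i j)"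
    and "\<And>k. k < n (i - 1) \<Longrightarrow> x k = y k"
  shows "affine_layer n \<theta> i x j = affine_layer n \<theta>' i y j"
  using assms by (simp add: affine_layer_def)

text \<open>The hypothesis speaks of \<open>pattern_layer\<close>, so \<open>A\<close> may come from
  another point: it suffices that the network gated by \<open>A\<close> reproduces the signs that
  \<open>A\<close> prescribes.\<close>

lemma hidden_layer_eq_pattern_layer:
  assumes "\<And>i j. i < m \<Longrightarrow> j < n (Suc i) \<Longrightarrow>
      (Suc i, j) \<in> A \<longleftrightarrow> affine_layer n \<theta> (Suc i) (pattern_layer n \<theta> A i x) j > 0"
  shows "i \<le> m \<Longrightarrow> j < n i \<Longrightarrow> hidden_layer n \<theta> i x j = pattern_layer n \<theta> A i x j"
proof (induction i arbitrary: j)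
  case (Suc i)
  have "affine_layer n \<theta> (Suc i) (hidden_layer n \<theta> i x) j
      = affine_layer n \<theta> (Suc i) (pattern_layer n \<theta> A i x) j"
    using Suc by (intro affine_layer_cong) auto
  then show ?case
    using assms[of i j] Suc.prems by (auto simp: ReLU_def)
qed simp

definition active_neurons ::
    "nat \<Rightarrow> (nat \<Rightarrow> nat) \<Rightarrow> (param \<Rightarrow> real) \<Rightarrow> (nat \<Rightarrow> real) \<Rightarrow> (nat \<times> nat) set" where
  "active_neurons m n \<theta> x =
     {(i, j) \<in> neurons m n. affine_layer n \<theta> i (hidden_layer n \<theta> (i - 1) x) j > 0}"

lemma hidden_layer_active_neurons:
  "i \<le> m \<Longrightarrow> j < n i \<Longrightarrow>
    hidden_layer n \<theta> i x j = pattern_layer n \<theta> (active_neurons m n \<theta> x) i x j"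
proof (induction i arbitrary: j)
  case (Suc i)
  have "affine_layer n \<theta> (Suc i) (hidden_layer n \<theta> i x) j
      = affine_layer n \<theta> (Suc i) (pattern_layer n \<theta> (active_neurons m n \<theta> x) i x) j"
    using Suc by (intro affine_layer_cong) auto
  then show ?case
    using Suc.prems by (auto simp: ReLU_def active_neurons_def neurons_def)
qed simp

text \<open>The pattern read off the true network is consistent with the network that it
  gates.\<close>

lemma active_neurons_iff:
  assumes "i < m" "j < n (Suc i)"
  shows "(Suc i, j) \<in> active_neurons m n \<theta> x \<longleftrightarrow>
    affine_layer n \<theta> (Suc i) (pattern_layer n \<theta> (active_neurons m n \<theta> x) i x) j > 0"
proof -
  have "affine_layer n \<theta> (Suc i) (hidden_layer n \<theta> i x) j
      = affine_layer n \<theta> (Suc i) (pattern_layer n \<theta> (active_neurons m n \<theta> x) i x) j"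
    using assms by (intro affine_layer_cong hidden_layer_active_neurons) auto
  moreover have "(Suc i, j) \<in> active_neurons m n \<theta> x \<longleftrightarrow>
      affine_layer n \<theta> (Suc i) (hidden_layer n \<theta> i x) j > 0"
    using assms by (simp add: active_neurons_def neurons_def)
  ultimately show ?thesis by simp
qed

text \<open>Layer \<open>i\<close> reads no parameters of later layers. Equality holds even at
  indices beyond the width, since indices outside \<open>A\<close> give 0 on both sides.\<close>

lemma pattern_layer_cong:
  assumes "A \<subseteq> neurons m n"
    and "\<And>l j k. 1 \<le> l \<Longrightarrow> l \<le> i \<Longrightarrow> l \<le> m \<Longrightarrow> j < n l \<Longrightarrow> k < n (l - 1) \<Longrightarrow>
      \<theta> (Weight l j k) = \<theta>' (Weight l j k)"
    and "\<And>l j. 1 \<le> l \<Longrightarrow> l \<le> i \<Longrightarrow> l \<le> m \<Longrightarrow> j < n l \<Longrightarrow> \<theta> (Bias l j) = \<theta>' (Bias l j)"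
  shows "pattern_layer n \<theta> A i x = pattern_layer n \<theta>' A i x"
  using assms(2,3)
proof (induction i)
  case (Suc i)
  have IH: "pattern_layer n \<theta> A i x = pattern_layer n \<theta>' A i x"
    using Suc.prems by (intro Suc.IH) auto
  have "affine_layer n \<theta> (Suc i) (pattern_layer n \<theta> A i x) j
      = affine_layer n \<theta>' (Suc i) (pattern_layer n \<theta>' A i x) j" if "(Suc i, j) \<in> A" for j
  proof -
    have "Suc i \<le> m" "j < n (Suc i)"
      using that assms(1) by (auto simp: neurons_def)
    then show ?thesis
      unfolding IH using Suc.prems by (intro affine_layer_cong) auto
  qed
  then show ?case by auto
qed simp

section \<open>Pre-activations as polynomials\<close>

text \<open>For \<open>i = Suc m\<close> and \<open>j = 0\<close> this is the output of the network
  gated by \<open>A\<close>.\<close>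

definition preactivation ::
    "(nat \<Rightarrow> nat) \<Rightarrow> (nat \<Rightarrow> 'n) \<Rightarrow> (param \<Rightarrow> 'd) \<Rightarrow> (nat \<times> nat) set \<Rightarrow> nat \<Rightarrow> nat \<Rightarrow>
      (real^'n) \<times> (real^'d) \<Rightarrow> real" where
  "preactivation n inp par A i j =
     (\<lambda>(x, s). affine_layer n (\<lambda>q. s $ par q) i
       (pattern_layer n (\<lambda>q. s $ par q) A (i - 1) (\<lambda>k. x $ inp k)) j)"

lemma real_polynomial_function_affine_layer:
  assumes "\<And>q. real_polynomial_function (\<lambda>z. \<theta> z q)" "\<And>k. real_polynomial_function (\<lambda>z. y z k)"
  shows "real_polynomial_function (\<lambda>z. affine_layer n (\<theta> z) i (y z) j)"
  unfolding affine_layer_def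
  by (intro real_polynomial_function.intros(3,4) real_polynomial_function_sum finite_lessThan assms)

lemma real_polynomial_function_coordinates:
  fixes i :: "'n::finite" and j :: "'d::finite"
  shows "real_polynomial_function (\<lambda>z :: (real^'n) \<times> (real^'d). fst z $ i)"
    and "real_polynomial_function (\<lambda>z :: (real^'n) \<times> (real^'d). snd z $ j)"
  by (auto intro!: real_polynomial_function.intros(1)
      bounded_linear_compose[OF bounded_linear_vec_nth bounded_linear_fst]
      bounded_linear_compose[OF bounded_linear_vec_nth bounded_linear_snd])

lemma real_polynomial_function_pattern_layer:
  fixes inp :: "nat \<Rightarrow> 'n::finite" and par :: "param \<Rightarrow> 'd::finite"
  shows "real_polynomial_function (\<lambda>z :: (real^'n) \<times> (real^'d).
    pattern_layer n (\<lambda>q. snd z $ par q) A i (\<lambda>k. fst z $ inp k) j)"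
proof (induction i arbitrary: j)
  case 0
  show ?case
    by (simp add: real_polynomial_function_coordinates)
next
  case (Suc i)
  show ?case
    using real_polynomial_function_affine_layer[OF real_polynomial_function_coordinates(2) Suc]
    by (cases "(Suc i, j) \<in> A") (auto simp: real_polynomial_function.intros(2))
qed

lemma real_polynomial_function_preactivation:
  fixes inp :: "nat \<Rightarrow> 'n::finite" and par :: "param \<Rightarrow> 'd::finite"
  shows "real_polynomial_function (preactivation n inp par A i j)"
  unfolding preactivation_def case_prod_unfold
  by (intro real_polynomial_function_affine_layer real_polynomial_function_coordinates
      real_polynomial_function_pattern_layer)

text \<open>The injectivity of \<open>par\<close> is only available on \<open>params m n\<close>: outside of this set, \<open>par\<close> may well
  hit the coordinate of the bias that is shifted.\<close>

lemma preactivation_shift_bias: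
  fixes inp :: "nat \<Rightarrow> 'n::finite" and par :: "param \<Rightarrow> 'd::finite"
  assumes inj: "inj_on par (params m n)" and A: "A \<subseteq> neurons m n" and ij: "(i, j) \<in> neurons m n"
  shows "preactivation n inp par A i j (z + t *\<^sub>R (0, axis (par (Bias i j)) 1))
    = preactivation n inp par A i j z + t"
proof -
  obtain x s where z: "z = (x, s)" by (cases z)
  define \<theta> where "\<theta> q = s $ par q" for q
  define \<theta>' where "\<theta>' q = (s + t *\<^sub>R axis (par (Bias i j)) 1) $ par q" for q
  have i: "1 \<le> i" "i \<le> m" "j < n i"
    using ij by (auto simp: neurons_def)
  then have "Bias i j \<in> params m n"
    by (auto simp: params_def)
  then have \<theta>': "\<theta>' q = \<theta> q" if "q \<in> params m n" "q \<noteq> Bias i j" for q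
    using inj_onD[OF inj, of q "Bias i j"] that by (auto simp: \<theta>_def \<theta>'_def axis_def)
  have bias: "\<theta>' (Bias i j) = \<theta> (Bias i j) + t"
    by (simp add: \<theta>_def \<theta>'_def axis_def)
  \<comment> \<open>Layers before \<open>i\<close> do not read \<open>Bias i j\<close>.\<close>
  have layer: "pattern_layer n \<theta>' A (i - 1) y = pattern_layer n \<theta> A (i - 1) y" for y
    using i by (intro pattern_layer_cong[OF A] \<theta>') (auto simp: params_def)
  have weight: "\<theta>' (Weight i j k) = \<theta> (Weight i j k)" if "k < n (i - 1)" for k
    using i that by (intro \<theta>') (auto simp: params_def)
  have "preactivation n inp par A i j (z + t *\<^sub>R (0, axis (par (Bias i j)) 1))
      = affine_layer n \<theta>' i (pattern_layer n \<theta>' A (i - 1) (\<lambda>k. x $ inp k)) j"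
    unfolding \<theta>'_def[abs_def] preactivation_def by (simp add: z)
  also have "\<dots> = affine_layer n \<theta> i (pattern_layer n \<theta> A (i - 1) (\<lambda>k. x $ inp k)) j + t"
    unfolding affine_layer_def layer by (simp add: bias weight)
  also have "\<dots> = preactivation n inp par A i j z + t"
    unfolding \<theta>_def[abs_def] preactivation_def by (simp add: z)
  finally show ?thesis .
qed

lemma negligible_preactivation_zeros:
  fixes inp :: "nat \<Rightarrow> 'n::finite" and par :: "param \<Rightarrow> 'd::finite"
  assumes "inj_on par (params m n)" "A \<subseteq> neurons m n" "(i, j) \<in> neurons m n"
  shows "negligible {z. preactivation n inp par A i j z = 0}"
proof (rule negligible_zeros_of_translation)
  show "(0, axis (par (Bias i j)) 1) \<in> (Basis :: ((real^'n) \<times> (real^'d)) set)"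
    by (simp add: Basis_prod_def image_iff)
  show "preactivation n inp par A i j differentiable (at z)" for z
    using real_polynomial_function_has_derivative[OF real_polynomial_function_preactivation]
    unfolding differentiable_def by blast
qed (rule preactivation_shift_bias[OF assms])

text \<open>Let \<open>A\<close> be the pattern at \<open>z\<close>. Near \<open>z\<close> all
  pre-activations gated by \<open>A\<close> keep their nonzero signs, so \<open>A\<close> remains
  the consistent pattern there and the family equals the output gated by \<open>A\<close>.\<close>

lemma relu_family_locally_polynomial:
  fixes inp :: "nat \<Rightarrow> 'n::finite" and par :: "param \<Rightarrow> 'd::finite"
  assumes nonzero: "\<And>A i j. A \<subseteq> neurons m n \<Longrightarrow> (i, j) \<in> neurons m n \<Longrightarrow>
      preactivation n inp par A i j z \<noteq> 0"
  shows "\<exists>U g. open U \<and> z \<in> U \<and> real_polynomial_function g \<and>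
    (\<forall>y\<in>U. relu_family m n inp par y = g y)"
proof -
  define A where "A = active_neurons m n (\<lambda>q. snd z $ par q) (\<lambda>k. fst z $ inp k)"
  have A: "A \<subseteq> neurons m n"
    by (auto simp: A_def active_neurons_def)
  \<comment> \<open>A positive product says that the signs at \<open>y\<close> and \<open>z\<close>
    agree.\<close>
  define U where "U = (\<Inter>(i, j)\<in>neurons m n.
    {y. preactivation n inp par A i j y * preactivation n inp par A i j z > 0})"
  have "continuous_on UNIV (preactivation n inp par A i j)" for i j
    by (intro continuous_at_imp_continuous_on ballI continuous_real_polymonial_function
        real_polynomial_function_preactivation)
  then have "open U"
    unfolding U_def
    by (auto intro!: open_INT finite_neurons open_Collect_less continuous_intros)
  have "z \<in> U"
    using nonzero[OF A] by (auto simp: U_def simp flip: power2_eq_square)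
  have "relu_family m n inp par y = preactivation n inp par A (Suc m) 0 y" if "y \<in> U" for y
  proof -
    have active: "(Suc i, j) \<in> A \<longleftrightarrow> affine_layer n (\<lambda>q. snd y $ par q) (Suc i)
        (pattern_layer n (\<lambda>q. snd y $ par q) A i (\<lambda>k. fst y $ inp k)) j > 0"
      if "i < m" "j < n (Suc i)" for i j
    proof -
      have "(Suc i, j) \<in> neurons m n"
        using that by (simp add: neurons_def)
      then have "preactivation n inp par A (Suc i) j y * preactivation n inp par A (Suc i) j z > 0"
        using \<open>y \<in> U\<close> unfolding U_def by blast
      moreover have "(Suc i, j) \<in> A \<longleftrightarrow> preactivation n inp par A (Suc i) j z > 0"
        using active_neurons_iff[where m = m and n = n, OF that] by (simp add: A_def preactivation_def case_prod_unfold)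
      ultimately have "(Suc i, j) \<in> A \<longleftrightarrow> preactivation n inp par A (Suc i) j y > 0"
        by (auto simp: zero_less_mult_iff)
      then show ?thesis
        by (simp add: preactivation_def case_prod_unfold)
    qed
    show ?thesis
      unfolding relu_family_def network_map_def preactivation_def case_prod_unfold
      by (rule affine_layer_cong) (simp_all add: hidden_layer_eq_pattern_layer[OF active])
  qed
  then show ?thesis
    using \<open>open U\<close> \<open>z \<in> U\<close> real_polynomial_function_preactivation
    by (intro exI[of _ U] exI[of _ "preactivation n inp par A (Suc m) 0"]) simp
qed

section \<open>The exceptional set\<close>

theorem theorem4:
  fixes m :: nat and n :: "nat \<Rightarrow> nat"
    and inp :: "nat \<Rightarrow> 'n::finite" and par :: "param \<Rightarrow> 'd::finite"
  assumes "architecture m n"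
    and "bij_betw inp {..<n 0} UNIV"
    and "bij_betw par (params m n) UNIV"
  shows "\<exists>Z :: ((real^'n) \<times> (real^'d)) set.
    algebraic_set Z \<and>
    smooth_on (relu_family m n inp par) (- Z) \<and>
    (\<exists>p. real_polynomial_function p \<and> Z = {z. p z = 0}) \<and>
    closed Z \<and> nowhere_dense Z \<and> Z \<in> null_sets lebesgue \<and>
    finite (components (- Z))"
proof -
  let ?N = "neurons m n"
  let ?I = "Pow ?N \<times> ?N"
  \<comment> \<open>One product turns the finite union of zero sets into the zero set of a single
    polynomial. All patterns are included, so \<open>Z\<close> does not depend on a point; for
    \<open>m = 0\<close> the product is empty and so is \<open>Z\<close>.\<close>
  define P where "P z = (\<Prod>t\<in>?I. preactivation n inp par (fst t) (fst (snd t)) (snd (snd t)) z)" for z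
  define Z where "Z = {z. P z = 0}"
  have fin: "finite ?I"
    by (simp add: finite_neurons)
  have P: "real_polynomial_function P"
    unfolding P_def[abs_def]
    by (intro real_polynomial_function_prod fin real_polynomial_function_preactivation)
  have Z_eq: "Z = (\<Union>t\<in>?I. {z. preactivation n inp par (fst t) (fst (snd t)) (snd (snd t)) z = 0})"
    unfolding Z_def P_def prod_zero_iff[OF fin] by blast
  have "algebraic_set Z"
    unfolding algebraic_set_def using P by (intro exI[of _ "{P}"]) (simp add: Z_def)
  moreover have "smooth_on (relu_family m n inp par) (- Z)"
    unfolding smooth_on_def
  proof (intro allI C_k_on_if_locally_polynomial relu_family_locally_polynomial notI)
    fix z A i j
    assume "z \<in> - Z" "A \<subseteq> ?N" "(i, j) \<in> ?N" "preactivation n inp par A i j z = 0"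
    then show False
      unfolding Z_eq by force
  qed
  moreover have "closed Z"
    unfolding Z_def
    using continuous_real_polymonial_function[OF P]
    by (intro closed_Collect_eq continuous_at_imp_continuous_on) auto
  moreover have negl: "negligible Z"
    unfolding Z_eq using fin negligible_preactivation_zeros[OF bij_betw_imp_inj_on[OF assms(3)]]
    by (intro negligible_Union) auto
  \<comment> \<open>A nonempty open set is not negligible. As \<open>Z\<close> is closed, this makes
    it nowhere dense.\<close>
  moreover have "interior Z = {}"
    using open_not_negligible[of "interior Z"] negligible_subset[OF negl interior_subset] by auto
  moreover have "finite (components (- Z))"
    unfolding Z_def using P by (rule finite_components_polynomial_complement)
  ultimately show ?thesis
    using P by (intro exI[of _ Z])
      (auto simp: nowhere_dense_def closure_closed negligible_iff_null_sets[symmetric] Z_def)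
qed

end
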